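(* Let $\mathbb{C}$ be a regular unital category with binary coproducts, comonadic covers $(P,\delta,\varepsilon)$ and a natural imaginary splitting $t$, and let $Y$ be an object of $\mathbb{C}$ with imaginary addition $\mu^Y$. Then $Y$ is an intrinsic Schreier special object if and only if its canonical imaginary magma structure $\mu^Y$ is a one-sided loop structure, i.e. if and only if there exists an imaginary morphism $q\colon Y\times Y\dashrightarrow Y$ such that $$\mu^Y\circ\langle q,\overline{\pi_2}\rangle=\overline{\pi_1}\qquad\text{and}\qquad q\circ\langle \mu^Y,\overline{\pi_2}\rangle=\overline{\pi_1},$$ where $\pi_1,\pi_2\colon Y\times Y\to Y$ are the product projections.
   Context: Setting. A pointed finitely complete category is unital when for all objects $A,B$ the pair $\langle 1_A,0\rangle\colon A\to A\times B$, $\langle 0,1_B\rangle\colon B\to A\times B$ is jointly extremal-epimorphic. "Comonadic covers" means a comonad $(P,\delta,\varepsilon)$ on $\mathbb{C}$ such that every $\varepsilon_X\colon P(X)\to X$ is a regular epimorphism. A natural imaginary splitting is a natural transformation with components $t_{A,B}\colon P(A\times B)\to A+B$ such that $r_{A,B}t_{A,B}=\varepsilon_{A\times B}$, where $r_{A,B}\colon A+B\to A\times B$ is the canonical comparison morphism (with $\pi_A r_{A,B}=(1_A\;0)$ and $\pi_B r_{A,B}=(0\;1_B)$). Imaginary morphisms. An imaginary morphism $a\colon X\dashrightarrow Y$ is a morphism $a\colon P(X)\to Y$ in $\mathbb{C}$, i.e. a morphism of the Kleisli category of $P$; composition of $a\colon A\dashrightarrow B$ and $b\colon B\dashrightarrow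 C$ is $b\circ a=b\,P(a)\,\delta_A$. A real morphism $f\colon X\to Y$ of $\mathbb{C}$ is viewed as $\overline{f}=f\varepsilon_X\colon X\dashrightarrow Y$; for real $v$, $u$ one writes $v\circ a=va\;(=\overline{v}\circ a)$ and $a\circ u=aP(u)\;(=a\circ\overline{u})$. Finite products of $\mathbb{C}$ are also products for imaginary morphisms: $\langle a,b\rangle\colon A\dashrightarrow X\times Y$ is the usual pairing of $a\colon P(A)\to X$ and $b\colon P(A)\to Y$ in $\mathbb{C}$. Imaginary addition: $\mu^X\colon X\times X\dashrightarrow X$ is $\mu^X=(1_X\;1_X)\,t_{X,X}\colon P(X\times X)\to X+X\to X$. Intrinsic Schreier split epimorphism: a split epimorphism $f\colon X\to Y$ with chosen section $s$ and kernel $k\colon K\to X$ for which there is an imaginary morphism $q\colon X\dashrightarrow K$ (imaginary retraction) with $\mu^X\circ\langle k\circ q,\overline{sf}\rangle=\overline{1_X}$ and $q\circ\mu^X\circ(k\times s)=\overline{\pi_K}$, where $\pi_K\colon K\times Y\to K$ is the projection. Intrinsic Schreier special object: an object $Y$ such that the split epimorphism $\pi_2\colon Y\times Y\to Y$ with section $\langle 1_Y,1_Y\rangle$ and kernel $\langle 1_Y,0\rangle$ is an intrinsic Schreier split epimorphism. *)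

theory Defs
  imports Main
begin

section \<open>Categories, functors, natural transformations\<close>

text \<open>
  Only the elements of \<open>obj\<close> and \<open>arr\<close> are objects and morphisms of the category; \<open>g \<cdot> f\<close>
  is meaningful if \<open>src g = tgt f\<close>.
\<close>

record ('o, 'm) cat =
  obj :: "'o set"
  arr :: "'m set"
  src :: "'m \<Rightarrow> 'o"
  tgt :: "'m \<Rightarrow> 'o"
  ident :: "'o \<Rightarrow> 'm"
  comp :: "'m \<Rightarrow> 'm \<Rightarrow> 'm" (infixl \<open>\<cdot>\<index>\<close> 70)

definition hom :: "('o, 'm, 'x) cat_scheme \<Rightarrow> 'o \<Rightarrow> 'o \<Rightarrow> 'm set" where
  "hom C A B = {f \<in> arr C. src C f = A \<and> tgt C f = B}"

locale category =
  fixes C :: "('o, 'm, 'x) cat_scheme" (structure)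
  assumes src_obj: "f \<in> arr C \<Longrightarrow> src C f \<in> obj C"
    and tgt_obj: "f \<in> arr C \<Longrightarrow> tgt C f \<in> obj C"
    and ident_hom: "A \<in> obj C \<Longrightarrow> ident C A \<in> hom C A A"
    and comp_hom: "\<lbrakk>f \<in> hom C A B; g \<in> hom C B D\<rbrakk> \<Longrightarrow> g \<cdot> f \<in> hom C A D"
    and ident_right: "f \<in> hom C A B \<Longrightarrow> f \<cdot> ident C A = f"
    and ident_left: "f \<in> hom C A B \<Longrightarrow> ident C B \<cdot> f = f"
    and comp_assoc:
      "\<lbrakk>f \<in> hom C A B; g \<in> hom C B D; h \<in> hom C D E\<rbrakk> \<Longrightarrow> h \<cdot> (g \<cdot> f) = (h \<cdot> g) \<cdot> f"

definition cat_functor ::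
  "('i, 'n, 'y) cat_scheme \<Rightarrow> ('o, 'm, 'x) cat_scheme \<Rightarrow> ('i \<Rightarrow> 'o) \<Rightarrow> ('n \<Rightarrow> 'm) \<Rightarrow> bool" where
  "cat_functor J C F0 F1 \<longleftrightarrow>
     (\<forall>A \<in> obj J. F0 A \<in> obj C) \<and>
     (\<forall>f \<in> arr J. F1 f \<in> hom C (F0 (src J f)) (F0 (tgt J f))) \<and>
     (\<forall>A \<in> obj J. F1 (ident J A) = ident C (F0 A)) \<and>
     (\<forall>f \<in> arr J. \<forall>g \<in> arr J. tgt J f = src J g \<longrightarrow>
        F1 (g \<cdot>\<^bsub>J\<^esub> f) = F1 g \<cdot>\<^bsub>C\<^esub> F1 f)"

definition natural_transformation ::
  "('i, 'n, 'y) cat_scheme \<Rightarrow> ('o, 'm, 'x) cat_scheme \<Rightarrow> ('i \<Rightarrow> 'o) \<Rightarrow> ('n \<Rightarrow> 'm)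
     \<Rightarrow> ('i \<Rightarrow> 'o) \<Rightarrow> ('n \<Rightarrow> 'm) \<Rightarrow> ('i \<Rightarrow> 'm) \<Rightarrow> bool" where
  "natural_transformation J C F0 F1 G0 G1 \<tau> \<longleftrightarrow>
     (\<forall>A \<in> obj J. \<tau> A \<in> hom C (F0 A) (G0 A)) \<and>
     (\<forall>f \<in> arr J. G1 f \<cdot>\<^bsub>C\<^esub> \<tau> (src J f) = \<tau> (tgt J f) \<cdot>\<^bsub>C\<^esub> F1 f)"


section \<open>Finite limits\<close>

definition is_cone ::
  "('i, 'n, 'y) cat_scheme \<Rightarrow> ('o, 'm, 'x) cat_scheme \<Rightarrow> ('i \<Rightarrow> 'o) \<Rightarrow> ('n \<Rightarrow> 'm)
     \<Rightarrow> 'o \<Rightarrow> ('i \<Rightarrow> 'm) \<Rightarrow> bool" where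
  "is_cone J C F0 F1 L p \<longleftrightarrow>
     L \<in> obj C \<and> (\<forall>j \<in> obj J. p j \<in> hom C L (F0 j)) \<and>
     (\<forall>u \<in> arr J. F1 u \<cdot>\<^bsub>C\<^esub> p (src J u) = p (tgt J u))"

definition is_limit ::
  "('i, 'n, 'y) cat_scheme \<Rightarrow> ('o, 'm, 'x) cat_scheme \<Rightarrow> ('i \<Rightarrow> 'o) \<Rightarrow> ('n \<Rightarrow> 'm)
     \<Rightarrow> 'o \<Rightarrow> ('i \<Rightarrow> 'm) \<Rightarrow> bool" where
  "is_limit J C F0 F1 L p \<longleftrightarrow>
     is_cone J C F0 F1 L p \<and>
     (\<forall>M r. is_cone J C F0 F1 M r \<longrightarrow>
        (\<exists>!h. h \<in> hom C M L \<and> (\<forall>j \<in> obj J. p j \<cdot>\<^bsub>C\<^esub> h = r j)))"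

text \<open>Every finite category is isomorphic to one whose objects and morphisms are natural numbers.\<close>

definition finitely_complete :: "('o, 'm, 'x) cat_scheme \<Rightarrow> bool" where
  "finitely_complete C \<longleftrightarrow>
     (\<forall>(J :: (nat, nat) cat) F0 F1.
        category J \<and> finite (obj J) \<and> finite (arr J) \<and> cat_functor J C F0 F1 \<longrightarrow>
        (\<exists>L p. is_limit J C F0 F1 L p))"


section \<open>Zero objects, monomorphisms, regular epimorphisms\<close>

definition zero_object :: "('o, 'm, 'x) cat_scheme \<Rightarrow> 'o \<Rightarrow> bool" where
  "zero_object C Z \<longleftrightarrow>
     Z \<in> obj C \<and> (\<forall>A \<in> obj C. (\<exists>!f. f \<in> hom C A Z) \<and> (\<exists>!f. f \<in> hom C Z A))"

definition pointed :: "('o, 'm, 'x) cat_scheme \<Rightarrow> bool" where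
  "pointed C \<longleftrightarrow> (\<exists>Z. zero_object C Z)"

definition zero_mor :: "('o, 'm, 'x) cat_scheme \<Rightarrow> 'o \<Rightarrow> 'o \<Rightarrow> 'm" where
  "zero_mor C A B =
     (THE f. \<exists>Z g h. zero_object C Z \<and> g \<in> hom C A Z \<and> h \<in> hom C Z B \<and> f = h \<cdot>\<^bsub>C\<^esub> g)"

definition monic :: "('o, 'm, 'x) cat_scheme \<Rightarrow> 'm \<Rightarrow> bool" where
  "monic C m \<longleftrightarrow>
     m \<in> arr C \<and>
     (\<forall>A. \<forall>u \<in> hom C A (src C m). \<forall>v \<in> hom C A (src C m).
        m \<cdot>\<^bsub>C\<^esub> u = m \<cdot>\<^bsub>C\<^esub> v \<longrightarrow> u = v)"

definition iso_mor :: "('o, 'm, 'x) cat_scheme \<Rightarrow> 'm \<Rightarrow> bool" where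
  "iso_mor C m \<longleftrightarrow>
     m \<in> arr C \<and>
     (\<exists>n \<in> hom C (tgt C m) (src C m).
        n \<cdot>\<^bsub>C\<^esub> m = ident C (src C m) \<and> m \<cdot>\<^bsub>C\<^esub> n = ident C (tgt C m))"

definition jointly_extremal_epi :: "('o, 'm, 'x) cat_scheme \<Rightarrow> 'm \<Rightarrow> 'm \<Rightarrow> bool" where
  "jointly_extremal_epi C f g \<longleftrightarrow>
     f \<in> arr C \<and> g \<in> arr C \<and> tgt C f = tgt C g \<and>
     (\<forall>m f' g'. monic C m \<and> tgt C m = tgt C f \<and>
        f' \<in> hom C (src C f) (src C m) \<and> m \<cdot>\<^bsub>C\<^esub> f' = f \<and>
        g' \<in> hom C (src C g) (src C m) \<and> m \<cdot>\<^bsub>C\<^esub> g' = g \<longrightarrow> iso_mor C m)"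

definition is_coequalizer :: "('o, 'm, 'x) cat_scheme \<Rightarrow> 'm \<Rightarrow> 'm \<Rightarrow> 'm \<Rightarrow> bool" where
  "is_coequalizer C u v e \<longleftrightarrow>
     u \<in> arr C \<and> v \<in> hom C (src C u) (tgt C u) \<and>
     e \<in> arr C \<and> src C e = tgt C u \<and> e \<cdot>\<^bsub>C\<^esub> u = e \<cdot>\<^bsub>C\<^esub> v \<and>
     (\<forall>g \<in> arr C. src C g = tgt C u \<and> g \<cdot>\<^bsub>C\<^esub> u = g \<cdot>\<^bsub>C\<^esub> v \<longrightarrow>
        (\<exists>!h. h \<in> hom C (tgt C e) (tgt C g) \<and> h \<cdot>\<^bsub>C\<^esub> e = g))"

definition regular_epi :: "('o, 'm, 'x) cat_scheme \<Rightarrow> 'm \<Rightarrow> bool" where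
  "regular_epi C e \<longleftrightarrow> (\<exists>u v. is_coequalizer C u v e)"

text \<open>In a pullback square \<open>f \<cdot> p = g \<cdot> q\<close>, the morphism \<open>p\<close> is the pullback of \<open>g\<close> along \<open>f\<close>.\<close>

definition is_pullback :: "('o, 'm, 'x) cat_scheme \<Rightarrow> 'm \<Rightarrow> 'm \<Rightarrow> 'm \<Rightarrow> 'm \<Rightarrow> bool" where
  "is_pullback C f g p q \<longleftrightarrow>
     f \<in> arr C \<and> g \<in> arr C \<and> tgt C f = tgt C g \<and>
     p \<in> arr C \<and> q \<in> arr C \<and> src C p = src C q \<and>
     tgt C p = src C f \<and> tgt C q = src C g \<and> f \<cdot>\<^bsub>C\<^esub> p = g \<cdot>\<^bsub>C\<^esub> q \<and>
     (\<forall>X. \<forall>a \<in> hom C X (src C f). \<forall>b \<in> hom C X (src C g).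
        f \<cdot>\<^bsub>C\<^esub> a = g \<cdot>\<^bsub>C\<^esub> b \<longrightarrow>
        (\<exists>!h. h \<in> hom C X (src C p) \<and> p \<cdot>\<^bsub>C\<^esub> h = a \<and> q \<cdot>\<^bsub>C\<^esub> h = b))"

definition is_kernel :: "('o, 'm, 'x) cat_scheme \<Rightarrow> 'm \<Rightarrow> 'm \<Rightarrow> bool" where
  "is_kernel C k f \<longleftrightarrow>
     f \<in> arr C \<and> k \<in> arr C \<and> tgt C k = src C f \<and>
     f \<cdot>\<^bsub>C\<^esub> k = zero_mor C (src C k) (tgt C f) \<and>
     (\<forall>A. \<forall>g \<in> hom C A (src C f). f \<cdot>\<^bsub>C\<^esub> g = zero_mor C A (tgt C f) \<longrightarrow>
        (\<exists>!h. h \<in> hom C A (src C k) \<and> k \<cdot>\<^bsub>C\<^esub> h = g))"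

definition regular_category :: "('o, 'm, 'x) cat_scheme \<Rightarrow> bool" where
  "regular_category C \<longleftrightarrow>
     category C \<and> finitely_complete C \<and>
     (\<forall>f u v. is_pullback C f f u v \<longrightarrow> (\<exists>e. is_coequalizer C u v e)) \<and>
     (\<forall>f g p q. is_pullback C f g p q \<and> regular_epi C g \<longrightarrow> regular_epi C p)"


section \<open>Chosen binary products and coproducts\<close>

record ('o, 'm) prod_coprod_cat = "('o, 'm) cat" +
  prd :: "'o \<Rightarrow> 'o \<Rightarrow> 'o" (infixl \<open>\<times>\<index>\<close> 75)
  pr1 :: "'o \<Rightarrow> 'o \<Rightarrow> 'm"
  pr2 :: "'o \<Rightarrow> 'o \<Rightarrow> 'm"
  coprd :: "'o \<Rightarrow> 'o \<Rightarrow> 'o" (infixl \<open>\<amalg>\<index>\<close> 72)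
  in1 :: "'o \<Rightarrow> 'o \<Rightarrow> 'm"
  in2 :: "'o \<Rightarrow> 'o \<Rightarrow> 'm"

definition binary_products :: "('o, 'm, 'x) prod_coprod_cat_scheme \<Rightarrow> bool" where
  "binary_products C \<longleftrightarrow>
     (\<forall>A \<in> obj C. \<forall>B \<in> obj C.
        A \<times>\<^bsub>C\<^esub> B \<in> obj C \<and>
        pr1 C A B \<in> hom C (A \<times>\<^bsub>C\<^esub> B) A \<and> pr2 C A B \<in> hom C (A \<times>\<^bsub>C\<^esub> B) B \<and>
        (\<forall>X. \<forall>f \<in> hom C X A. \<forall>g \<in> hom C X B.
           \<exists>!h. h \<in> hom C X (A \<times>\<^bsub>C\<^esub> B) \<and>
                pr1 C A B \<cdot>\<^bsub>C\<^esub> h = f \<and> pr2 C A B \<cdot>\<^bsub>C\<^esub> h = g))"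

definition binary_coproducts :: "('o, 'm, 'x) prod_coprod_cat_scheme \<Rightarrow> bool" where
  "binary_coproducts C \<longleftrightarrow>
     (\<forall>A \<in> obj C. \<forall>B \<in> obj C.
        A \<amalg>\<^bsub>C\<^esub> B \<in> obj C \<and>
        in1 C A B \<in> hom C A (A \<amalg>\<^bsub>C\<^esub> B) \<and> in2 C A B \<in> hom C B (A \<amalg>\<^bsub>C\<^esub> B) \<and>
        (\<forall>X. \<forall>f \<in> hom C A X. \<forall>g \<in> hom C B X.
           \<exists>!h. h \<in> hom C (A \<amalg>\<^bsub>C\<^esub> B) X \<and>
                h \<cdot>\<^bsub>C\<^esub> in1 C A B = f \<and> h \<cdot>\<^bsub>C\<^esub> in2 C A B = g))"

definition pairing :: "('o, 'm, 'x) prod_coprod_cat_scheme \<Rightarrow> 'm \<Rightarrow> 'm \<Rightarrow> 'm" where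
  "pairing C f g =
     (THE h. h \<in> hom C (src C f) (tgt C f \<times>\<^bsub>C\<^esub> tgt C g) \<and>
             pr1 C (tgt C f) (tgt C g) \<cdot>\<^bsub>C\<^esub> h = f \<and> pr2 C (tgt C f) (tgt C g) \<cdot>\<^bsub>C\<^esub> h = g)"

definition copairing :: "('o, 'm, 'x) prod_coprod_cat_scheme \<Rightarrow> 'm \<Rightarrow> 'm \<Rightarrow> 'm" where
  "copairing C f g =
     (THE h. h \<in> hom C (src C f \<amalg>\<^bsub>C\<^esub> src C g) (tgt C f) \<and>
             h \<cdot>\<^bsub>C\<^esub> in1 C (src C f) (src C g) = f \<and> h \<cdot>\<^bsub>C\<^esub> in2 C (src C f) (src C g) = g)"

definition prod_mor :: "('o, 'm, 'x) prod_coprod_cat_scheme \<Rightarrow> 'm \<Rightarrow> 'm \<Rightarrow> 'm" where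
  "prod_mor C f g =
     pairing C (f \<cdot>\<^bsub>C\<^esub> pr1 C (src C f) (src C g)) (g \<cdot>\<^bsub>C\<^esub> pr2 C (src C f) (src C g))"

definition coprod_mor :: "('o, 'm, 'x) prod_coprod_cat_scheme \<Rightarrow> 'm \<Rightarrow> 'm \<Rightarrow> 'm" where
  "coprod_mor C f g =
     copairing C (in1 C (tgt C f) (tgt C g) \<cdot>\<^bsub>C\<^esub> f) (in2 C (tgt C f) (tgt C g) \<cdot>\<^bsub>C\<^esub> g)"

text \<open>
  Finite completeness already yields binary products; \<open>binary_products\<close> says that the product
  data carried by \<open>C\<close> is a choice of them.
\<close>

definition unital_category :: "('o, 'm, 'x) prod_coprod_cat_scheme \<Rightarrow> bool" where
  "unital_category C \<longleftrightarrow>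
     category C \<and> pointed C \<and> finitely_complete C \<and> binary_products C \<and>
     (\<forall>A \<in> obj C. \<forall>B \<in> obj C.
        jointly_extremal_epi C
          (pairing C (ident C A) (zero_mor C A B))
          (pairing C (zero_mor C B A) (ident C B)))"

definition comparison :: "('o, 'm, 'x) prod_coprod_cat_scheme \<Rightarrow> 'o \<Rightarrow> 'o \<Rightarrow> 'm" where
  "comparison C A B =
     pairing C (copairing C (ident C A) (zero_mor C B A)) (copairing C (zero_mor C A B) (ident C B))"


section \<open>Comonadic covers and imaginary morphisms\<close>

record ('o, 'm) comonad_data =
  Pob :: "'o \<Rightarrow> 'o"
  Pmor :: "'m \<Rightarrow> 'm"
  comult :: "'o \<Rightarrow> 'm"
  counit :: "'o \<Rightarrow> 'm"

definition comonad :: "('o, 'm, 'x) cat_scheme \<Rightarrow> ('o, 'm) comonad_data \<Rightarrow> bool" where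
  "comonad C P \<longleftrightarrow>
     cat_functor C C (Pob P) (Pmor P) \<and>
     natural_transformation C C (Pob P) (Pmor P) (\<lambda>X. Pob P (Pob P X)) (\<lambda>f. Pmor P (Pmor P f))
       (comult P) \<and>
     natural_transformation C C (Pob P) (Pmor P) (\<lambda>X. X) (\<lambda>f. f) (counit P) \<and>
     (\<forall>X \<in> obj C.
        counit P (Pob P X) \<cdot>\<^bsub>C\<^esub> comult P X = ident C (Pob P X) \<and>
        Pmor P (counit P X) \<cdot>\<^bsub>C\<^esub> comult P X = ident C (Pob P X) \<and>
        comult P (Pob P X) \<cdot>\<^bsub>C\<^esub> comult P X = Pmor P (comult P X) \<cdot>\<^bsub>C\<^esub> comult P X)"

definition comonadic_covers :: "('o, 'm, 'x) cat_scheme \<Rightarrow> ('o, 'm) comonad_data \<Rightarrow> bool" where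
  "comonadic_covers C P \<longleftrightarrow> comonad C P \<and> (\<forall>X \<in> obj C. regular_epi C (counit P X))"

definition natural_imaginary_splitting ::
  "('o, 'm, 'x) prod_coprod_cat_scheme \<Rightarrow> ('o, 'm) comonad_data \<Rightarrow> ('o \<Rightarrow> 'o \<Rightarrow> 'm) \<Rightarrow> bool" where
  "natural_imaginary_splitting C P t \<longleftrightarrow>
     (\<forall>A \<in> obj C. \<forall>B \<in> obj C.
        t A B \<in> hom C (Pob P (A \<times>\<^bsub>C\<^esub> B)) (A \<amalg>\<^bsub>C\<^esub> B) \<and>
        comparison C A B \<cdot>\<^bsub>C\<^esub> t A B = counit P (A \<times>\<^bsub>C\<^esub> B)) \<and>
     (\<forall>f \<in> arr C. \<forall>g \<in> arr C.
        coprod_mor C f g \<cdot>\<^bsub>C\<^esub> t (src C f) (src C g) =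
        t (tgt C f) (tgt C g) \<cdot>\<^bsub>C\<^esub> Pmor P (prod_mor C f g))"

text \<open>
  An imaginary morphism from \<open>X\<close> to \<open>Y\<close> is a morphism \<open>P(X) \<rightarrow> Y\<close>. Its imaginary domain \<open>X\<close> is
  not determined by the underlying morphism (\<open>P\<close> need not be injective on objects), so the
  composition \<open>b \<circ> a\<close> takes the imaginary domain of \<open>a\<close> as an explicit argument. For real \<open>v\<close>
  and \<open>u\<close>, the composites \<open>v \<circ> a\<close> and \<open>a \<circ> u\<close> are written out as \<open>v \<cdot> a\<close> and \<open>a \<cdot> P(u)\<close> below.
\<close>

definition imag :: "('o, 'm, 'x) cat_scheme \<Rightarrow> ('o, 'm) comonad_data \<Rightarrow> 'o \<Rightarrow> 'o \<Rightarrow> 'm set" where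
  "imag C P X Y = hom C (Pob P X) Y"

definition imag_comp ::
  "('o, 'm, 'x) cat_scheme \<Rightarrow> ('o, 'm) comonad_data \<Rightarrow> 'o \<Rightarrow> 'm \<Rightarrow> 'm \<Rightarrow> 'm" where
  "imag_comp C P A b a = b \<cdot>\<^bsub>C\<^esub> Pmor P a \<cdot>\<^bsub>C\<^esub> comult P A"

definition real_mor :: "('o, 'm, 'x) cat_scheme \<Rightarrow> ('o, 'm) comonad_data \<Rightarrow> 'm \<Rightarrow> 'm" where
  "real_mor C P f = f \<cdot>\<^bsub>C\<^esub> counit P (src C f)"

definition imag_add :: "('o, 'm, 'x) prod_coprod_cat_scheme \<Rightarrow> ('o \<Rightarrow> 'o \<Rightarrow> 'm) \<Rightarrow> 'o \<Rightarrow> 'm" where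
  "imag_add C t X = copairing C (ident C X) (ident C X) \<cdot>\<^bsub>C\<^esub> t X X"


section \<open>Intrinsic Schreier special objects and one-sided loops\<close>

definition intrinsic_schreier_split_epi ::
  "('o, 'm, 'x) prod_coprod_cat_scheme \<Rightarrow> ('o, 'm) comonad_data \<Rightarrow> ('o \<Rightarrow> 'o \<Rightarrow> 'm)
     \<Rightarrow> 'm \<Rightarrow> 'm \<Rightarrow> 'm \<Rightarrow> bool" where
  "intrinsic_schreier_split_epi C P t f s k \<longleftrightarrow>
     f \<in> arr C \<and> s \<in> hom C (tgt C f) (src C f) \<and> f \<cdot>\<^bsub>C\<^esub> s = ident C (tgt C f) \<and>
     is_kernel C k f \<and>
     (let X = src C f; Y = tgt C f; K = src C k in
      \<exists>q \<in> imag C P X K.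
        imag_comp C P X (imag_add C t X) (pairing C (k \<cdot>\<^bsub>C\<^esub> q) (real_mor C P (s \<cdot>\<^bsub>C\<^esub> f)))
          = real_mor C P (ident C X) \<and>
        imag_comp C P (K \<times>\<^bsub>C\<^esub> Y) q (imag_add C t X \<cdot>\<^bsub>C\<^esub> Pmor P (prod_mor C k s))
          = real_mor C P (pr1 C K Y))"

definition intrinsic_schreier_special ::
  "('o, 'm, 'x) prod_coprod_cat_scheme \<Rightarrow> ('o, 'm) comonad_data \<Rightarrow> ('o \<Rightarrow> 'o \<Rightarrow> 'm) \<Rightarrow> 'o \<Rightarrow> bool" where
  "intrinsic_schreier_special C P t Y \<longleftrightarrow>
     Y \<in> obj C \<and>
     intrinsic_schreier_split_epi C P t
       (pr2 C Y Y) (pairing C (ident C Y) (ident C Y)) (pairing C (ident C Y) (zero_mor C Y Y))"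

definition one_sided_loop_structure ::
  "('o, 'm, 'x) prod_coprod_cat_scheme \<Rightarrow> ('o, 'm) comonad_data \<Rightarrow> 'o \<Rightarrow> 'm \<Rightarrow> bool" where
  "one_sided_loop_structure C P Y m \<longleftrightarrow>
     m \<in> imag C P (Y \<times>\<^bsub>C\<^esub> Y) Y \<and>
     (\<exists>q \<in> imag C P (Y \<times>\<^bsub>C\<^esub> Y) Y.
        imag_comp C P (Y \<times>\<^bsub>C\<^esub> Y) m (pairing C q (real_mor C P (pr2 C Y Y)))
          = real_mor C P (pr1 C Y Y) \<and>
        imag_comp C P (Y \<times>\<^bsub>C\<^esub> Y) q (pairing C m (real_mor C P (pr2 C Y Y)))
          = real_mor C P (pr1 C Y Y))"

end

theory Submission
  imports Defs
begin

text \<open>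
  The theorem holds because the imaginary addition is natural in its object. In particular the
  projections \<open>\<pi>\<^sub>1, \<pi>\<^sub>2\<close> of \<open>Y \<times> Y\<close> carry \<open>\<mu>\<close> on \<open>Y \<times> Y\<close> to \<open>\<mu>\<close> on \<open>Y\<close>, so that the addition of
  \<open>Y \<times> Y\<close> is computed componentwise. For the split epimorphism \<open>\<pi>\<^sub>2\<close> with section \<open>s = \<langle>1, 1\<rangle>\<close> and
  kernel \<open>k = \<langle>1, 0\<rangle>\<close> one has \<open>\<pi>\<^sub>1 k = 1\<close>, \<open>\<pi>\<^sub>2 k = 0\<close> and \<open>\<pi>\<^sub>1 s = \<pi>\<^sub>2 s = 1\<close>, and therefore, for
  any imaginary \<open>q\<close> from \<open>Y \<times> Y\<close> to \<open>Y\<close>: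

  \<^item> the imaginary morphism \<open>\<mu> \<circ> \<langle>k q, s \<pi>\<^sub>2\<rangle>\<close> has first component \<open>\<mu> \<circ> \<langle>q, \<pi>\<^sub>2\<rangle>\<close> and second component
    \<open>\<mu> \<circ> \<langle>0, \<pi>\<^sub>2\<rangle>\<close>;
  \<^item> the imaginary morphism \<open>\<mu> \<circ> (k \<times> s)\<close> has first component \<open>\<mu>\<close> and second component \<open>\<mu> \<circ> (0 \<times> 1)\<close>.

  Since \<open>0\<close> is a left unit of \<open>\<mu>\<close> (lemmas \<open>imag_add_zero_prod\<close> and \<open>imag_add_zero_left\<close>), both
  second components are \<open>\<pi>\<^sub>2\<close>. The first Schreier equation thus amounts to its first component,
  which is the first loop equation. The second Schreier equation becomes the second loop equation
  because \<open>\<mu> \<circ> (k \<times> s) = \<langle>\<mu>, \<pi>\<^sub>2\<rangle>\<close>. So the same \<open>q\<close>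
  serves on both sides of the equivalence.

  The left unit law comes from the splitting: by naturality of \<open>t\<close> with respect to \<open>0\<close> and \<open>w\<close>,
  \<open>\<mu> P(0 \<times> w) = (1 1) (0 + w) t = (0 w) t\<close>, and \<open>(0 w) = w \<pi>\<^sub>2 r\<close> factors through the comparison
  morphism \<open>r\<close>, for which \<open>r t\<close> is the counit.
\<close>

section \<open>Zero morphisms, products and coproducts\<close>

lemma ex1_elements_eq: "\<exists>!x. Q x \<Longrightarrow> Q a \<Longrightarrow> Q b \<Longrightarrow> a = b"
  by auto

lemma homD: "f \<in> hom C A B \<Longrightarrow> f \<in> arr C" "f \<in> hom C A B \<Longrightarrow> src C f = A"
  "f \<in> hom C A B \<Longrightarrow> tgt C f = B"
  by (simp_all add: hom_def)

locale pointed_category_with_products_coproducts = category C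
  for C :: "('o, 'm, 'x) prod_coprod_cat_scheme" (structure) +
  assumes pointed: "pointed C"
    and binary_products: "binary_products C"
    and binary_coproducts: "binary_coproducts C"
begin

lemma hom_obj:
  assumes "f \<in> hom C A B"
  shows "A \<in> obj C" "B \<in> obj C"
  using assms src_obj[of f] tgt_obj[of f] by (auto simp: hom_def)

lemma
  assumes "zero_object C Z" "A \<in> obj C"
  shows ex1_hom_to_zero: "\<exists>!f. f \<in> hom C A Z"
    and ex1_hom_from_zero: "\<exists>!f. f \<in> hom C Z A"
  using assms by (simp_all add: zero_object_def)

text \<open>Two factorisations through zero objects agree, so the description of \<open>zero_mor\<close> is definite.\<close>

lemma zero_mor_factor:
  assumes Z: "zero_object C Z" and g: "g \<in> hom C A Z" and h: "h \<in> hom C Z B"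
  shows "zero_mor C A B = h \<cdot> g"
  unfolding zero_mor_def
proof (rule the_equality)
  show "\<exists>Z' g' h'. zero_object C Z' \<and> g' \<in> hom C A Z' \<and> h' \<in> hom C Z' B \<and> h \<cdot> g = h' \<cdot> g'"
    using assms by blast
next
  fix f
  assume "\<exists>Z' g' h'. zero_object C Z' \<and> g' \<in> hom C A Z' \<and> h' \<in> hom C Z' B \<and> f = h' \<cdot> g'"
  then obtain Z' g' h' where Z': "zero_object C Z'" and g': "g' \<in> hom C A Z'"
    and h': "h' \<in> hom C Z' B" and f: "f = h' \<cdot> g'" by blast
  obtain i where i: "i \<in> hom C Z Z'"
    using ex1_implies_ex[OF ex1_hom_to_zero[OF Z' hom_obj(2)[OF g]]] by blast
  have "i \<cdot> g = g'"
    by (rule ex1_elements_eq[OF ex1_hom_to_zero[OF Z' hom_obj(1)[OF g]] comp_hom[OF g i] g'])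
  moreover have "h' \<cdot> i = h"
    by (rule ex1_elements_eq[OF ex1_hom_from_zero[OF Z hom_obj(2)[OF h]] comp_hom[OF i h'] h])
  ultimately show "f = h \<cdot> g"
    using f comp_assoc[OF g i h'] by simp
qed

lemma zero_mor_obtain:
  assumes "A \<in> obj C" "B \<in> obj C"
  obtains Z g h where "zero_object C Z" "g \<in> hom C A Z" "h \<in> hom C Z B" "zero_mor C A B = h \<cdot> g"
proof -
  obtain Z where Z: "zero_object C Z" using pointed unfolding pointed_def by blast
  obtain g h where gh: "g \<in> hom C A Z" "h \<in> hom C Z B"
    using ex1_implies_ex[OF ex1_hom_to_zero[OF Z assms(1)]]
      ex1_implies_ex[OF ex1_hom_from_zero[OF Z assms(2)]] by blast
  show thesis using that[OF Z gh zero_mor_factor[OF Z gh]] .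
qed

lemma zero_mor_hom: "A \<in> obj C \<Longrightarrow> B \<in> obj C \<Longrightarrow> zero_mor C A B \<in> hom C A B"
  by (rule zero_mor_obtain[of A B]) (auto intro: comp_hom)

lemma comp_zero_mor:
  assumes "A \<in> obj C" and f: "f \<in> hom C B D"
  shows "f \<cdot> zero_mor C A B = zero_mor C A D"
proof -
  obtain Z g h where *: "zero_object C Z" "g \<in> hom C A Z" "h \<in> hom C Z B"
    "zero_mor C A B = h \<cdot> g"
    by (rule zero_mor_obtain[OF assms(1) hom_obj(1)[OF f]])
  show ?thesis
    using *(4) comp_assoc[OF *(2,3) f] zero_mor_factor[OF *(1,2) comp_hom[OF *(3) f]] by simp
qed

lemma zero_mor_comp:
  assumes f: "f \<in> hom C A B" and "D \<in> obj C"
  shows "zero_mor C B D \<cdot> f = zero_mor C A D"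
proof -
  obtain Z g h where *: "zero_object C Z" "g \<in> hom C B Z" "h \<in> hom C Z D"
    "zero_mor C B D = h \<cdot> g"
    by (rule zero_mor_obtain[OF hom_obj(2)[OF f] assms(2)])
  show ?thesis
    using *(4) comp_assoc[OF f *(2,3)] zero_mor_factor[OF *(1) comp_hom[OF f *(2)] *(3)] by simp
qed

lemma
  assumes "A \<in> obj C" "B \<in> obj C"
  shows prd_obj: "A \<times>\<^bsub>C\<^esub> B \<in> obj C"
    and pr1_hom: "pr1 C A B \<in> hom C (A \<times>\<^bsub>C\<^esub> B) A"
    and pr2_hom: "pr2 C A B \<in> hom C (A \<times>\<^bsub>C\<^esub> B) B"
  using binary_products assms by (simp_all add: binary_products_def)

lemma ex1_pairing:
  assumes "f \<in> hom C X A" "g \<in> hom C X B"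
  shows "\<exists>!h. h \<in> hom C X (A \<times>\<^bsub>C\<^esub> B) \<and> pr1 C A B \<cdot> h = f \<and> pr2 C A B \<cdot> h = g"
  using binary_products assms hom_obj(2)[OF assms(1)] hom_obj(2)[OF assms(2)]
  by (simp add: binary_products_def)

lemma
  assumes f: "f \<in> hom C X A" and g: "g \<in> hom C X B"
  shows pairing_hom: "pairing C f g \<in> hom C X (A \<times>\<^bsub>C\<^esub> B)"
    and pr1_pairing: "pr1 C A B \<cdot> pairing C f g = f"
    and pr2_pairing: "pr2 C A B \<cdot> pairing C f g = g"
proof -
  from theI'[OF ex1_pairing[OF f g]]
  show "pairing C f g \<in> hom C X (A \<times>\<^bsub>C\<^esub> B)" "pr1 C A B \<cdot> pairing C f g = f"
    "pr2 C A B \<cdot> pairing C f g = g"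
    unfolding pairing_def homD(2)[OF f] homD(3)[OF f] homD(3)[OF g] by simp_all
qed

lemma prd_eqI:
  assumes "g \<in> hom C X (A \<times>\<^bsub>C\<^esub> B)" "h \<in> hom C X (A \<times>\<^bsub>C\<^esub> B)" "A \<in> obj C" "B \<in> obj C"
    and "pr1 C A B \<cdot> g = pr1 C A B \<cdot> h" "pr2 C A B \<cdot> g = pr2 C A B \<cdot> h"
  shows "g = h"
  using ex1_elements_eq[OF ex1_pairing[OF comp_hom[OF assms(2) pr1_hom[OF assms(3,4)]]
      comp_hom[OF assms(2) pr2_hom[OF assms(3,4)]]], of g h] assms(1,2,5,6) by simp

lemma pairing_comp:
  assumes f: "f \<in> hom C X A" and g: "g \<in> hom C X B" and u: "u \<in> hom C W X"
  shows "pairing C f g \<cdot> u = pairing C (f \<cdot> u) (g \<cdot> u)"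
proof (rule prd_eqI)
  note fg = pairing_hom[OF f g]
  note fu = comp_hom[OF u f] and gu = comp_hom[OF u g]
  show A: "A \<in> obj C" and B: "B \<in> obj C" by (rule hom_obj[OF f] hom_obj[OF g])+
  show "pairing C f g \<cdot> u \<in> hom C W (A \<times>\<^bsub>C\<^esub> B)" using comp_hom[OF u fg] .
  show "pairing C (f \<cdot> u) (g \<cdot> u) \<in> hom C W (A \<times>\<^bsub>C\<^esub> B)" using pairing_hom[OF fu gu] .
  show "pr1 C A B \<cdot> (pairing C f g \<cdot> u) = pr1 C A B \<cdot> pairing C (f \<cdot> u) (g \<cdot> u)"
    using comp_assoc[OF u fg pr1_hom[OF A B]] pr1_pairing[OF f g] pr1_pairing[OF fu gu] by simp
  show "pr2 C A B \<cdot> (pairing C f g \<cdot> u) = pr2 C A B \<cdot> pairing C (f \<cdot> u) (g \<cdot> u)"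
    using comp_assoc[OF u fg pr2_hom[OF A B]] pr2_pairing[OF f g] pr2_pairing[OF fu gu] by simp
qed

lemma prod_mor_eq:
  assumes "f \<in> hom C A A'" and "g \<in> hom C B B'"
  shows "prod_mor C f g = pairing C (f \<cdot> pr1 C A B) (g \<cdot> pr2 C A B)"
  using assms by (simp add: prod_mor_def homD)

lemma prod_mor_hom:
  assumes f: "f \<in> hom C A A'" and g: "g \<in> hom C B B'"
  shows "prod_mor C f g \<in> hom C (A \<times>\<^bsub>C\<^esub> B) (A' \<times>\<^bsub>C\<^esub> B')"
  unfolding prod_mor_eq[OF f g]
  by (rule pairing_hom[OF comp_hom[OF pr1_hom f] comp_hom[OF pr2_hom g]])
    (rule hom_obj(1)[OF f] hom_obj(1)[OF g])+

lemma prod_mor_pairing: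
  assumes a: "a \<in> hom C X A" and b: "b \<in> hom C X B"
    and f: "f \<in> hom C A A'" and g: "g \<in> hom C B B'"
  shows "prod_mor C f g \<cdot> pairing C a b = pairing C (f \<cdot> a) (g \<cdot> b)"
proof -
  note p1 = pr1_hom[OF hom_obj(1)[OF f] hom_obj(1)[OF g]]
    and p2 = pr2_hom[OF hom_obj(1)[OF f] hom_obj(1)[OF g]]
    and ab = pairing_hom[OF a b]
  show ?thesis
    using pairing_comp[OF comp_hom[OF p1 f] comp_hom[OF p2 g] ab]
      comp_assoc[OF ab p1 f] comp_assoc[OF ab p2 g] pr1_pairing[OF a b] pr2_pairing[OF a b]
    by (simp add: prod_mor_eq[OF f g])
qed

lemma prod_mor_comp:
  assumes a: "a \<in> hom C A A'" and b: "b \<in> hom C B B'"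
    and f: "f \<in> hom C A' A''" and g: "g \<in> hom C B' B''"
  shows "prod_mor C f g \<cdot> prod_mor C a b = prod_mor C (f \<cdot> a) (g \<cdot> b)"
proof -
  note p1 = pr1_hom[OF hom_obj(1)[OF a] hom_obj(1)[OF b]]
    and p2 = pr2_hom[OF hom_obj(1)[OF a] hom_obj(1)[OF b]]
  show ?thesis
    using prod_mor_pairing[OF comp_hom[OF p1 a] comp_hom[OF p2 b] f g]
      comp_assoc[OF p1 a f] comp_assoc[OF p2 b g]
    by (simp add: prod_mor_eq[OF a b] prod_mor_eq[OF comp_hom[OF a f] comp_hom[OF b g]])
qed

lemma
  assumes "A \<in> obj C" "B \<in> obj C"
  shows coprd_obj: "A \<amalg> B \<in> obj C"
    and in1_hom: "in1 C A B \<in> hom C A (A \<amalg> B)"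
    and in2_hom: "in2 C A B \<in> hom C B (A \<amalg> B)"
  using binary_coproducts assms by (simp_all add: binary_coproducts_def)

lemma ex1_copairing:
  assumes "f \<in> hom C A X" "g \<in> hom C B X"
  shows "\<exists>!h. h \<in> hom C (A \<amalg> B) X \<and> h \<cdot> in1 C A B = f \<and> h \<cdot> in2 C A B = g"
  using binary_coproducts assms hom_obj(1)[OF assms(1)] hom_obj(1)[OF assms(2)]
  by (simp add: binary_coproducts_def)

lemma
  assumes f: "f \<in> hom C A X" and g: "g \<in> hom C B X"
  shows copairing_hom: "copairing C f g \<in> hom C (A \<amalg> B) X"
    and copairing_in1: "copairing C f g \<cdot> in1 C A B = f"
    and copairing_in2: "copairing C f g \<cdot> in2 C A B = g"
proof -
  from theI'[OF ex1_copairing[OF f g]]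
  show "copairing C f g \<in> hom C (A \<amalg> B) X" "copairing C f g \<cdot> in1 C A B = f"
    "copairing C f g \<cdot> in2 C A B = g"
    unfolding copairing_def homD(3)[OF f] homD(2)[OF f] homD(2)[OF g] by simp_all
qed

lemma coprd_eqI:
  assumes "g \<in> hom C (A \<amalg> B) X" "h \<in> hom C (A \<amalg> B) X" "A \<in> obj C" "B \<in> obj C"
    and "g \<cdot> in1 C A B = h \<cdot> in1 C A B" "g \<cdot> in2 C A B = h \<cdot> in2 C A B"
  shows "g = h"
  using ex1_elements_eq[OF ex1_copairing[OF comp_hom[OF in1_hom[OF assms(3,4)] assms(2)]
      comp_hom[OF in2_hom[OF assms(3,4)] assms(2)]], of g h] assms(1,2,5,6) by simp

lemma comp_copairing:
  assumes f: "f \<in> hom C A X" and g: "g \<in> hom C B X" and v: "v \<in> hom C X W"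
  shows "v \<cdot> copairing C f g = copairing C (v \<cdot> f) (v \<cdot> g)"
proof (rule coprd_eqI)
  note fg = copairing_hom[OF f g]
  note vf = comp_hom[OF f v] and vg = comp_hom[OF g v]
  show A: "A \<in> obj C" and B: "B \<in> obj C" by (rule hom_obj[OF f] hom_obj[OF g])+
  show "v \<cdot> copairing C f g \<in> hom C (A \<amalg> B) W" using comp_hom[OF fg v] .
  show "copairing C (v \<cdot> f) (v \<cdot> g) \<in> hom C (A \<amalg> B) W" using copairing_hom[OF vf vg] .
  show "v \<cdot> copairing C f g \<cdot> in1 C A B = copairing C (v \<cdot> f) (v \<cdot> g) \<cdot> in1 C A B"
    using comp_assoc[OF in1_hom[OF A B] fg v] copairing_in1[OF f g] copairing_in1[OF vf vg] by simp
  show "v \<cdot> copairing C f g \<cdot> in2 C A B = copairing C (v \<cdot> f) (v \<cdot> g) \<cdot> in2 C A B"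
    using comp_assoc[OF in2_hom[OF A B] fg v] copairing_in2[OF f g] copairing_in2[OF vf vg] by simp
qed

lemma coprod_mor_hom:
  assumes f: "f \<in> hom C A A'" and g: "g \<in> hom C B B'"
  shows "coprod_mor C f g \<in> hom C (A \<amalg> B) (A' \<amalg> B')"
proof -
  note A' = hom_obj(2)[OF f] and B' = hom_obj(2)[OF g]
  show ?thesis
    using copairing_hom[OF comp_hom[OF f in1_hom[OF A' B']] comp_hom[OF g in2_hom[OF A' B']]]
    by (simp add: coprod_mor_def homD(3)[OF f] homD(3)[OF g])
qed

lemma copairing_coprod_mor:
  assumes f: "f \<in> hom C A A'" and g: "g \<in> hom C B B'"
    and a: "a \<in> hom C A' X" and b: "b \<in> hom C B' X"
  shows "copairing C a b \<cdot> coprod_mor C f g = copairing C (a \<cdot> f) (b \<cdot> g)"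
proof -
  note i1 = in1_hom[OF hom_obj(2)[OF f] hom_obj(2)[OF g]]
    and i2 = in2_hom[OF hom_obj(2)[OF f] hom_obj(2)[OF g]]
    and ab = copairing_hom[OF a b]
  show ?thesis
    using comp_copairing[OF comp_hom[OF f i1] comp_hom[OF g i2] ab]
      comp_assoc[OF f i1 ab] comp_assoc[OF g i2 ab] copairing_in1[OF a b] copairing_in2[OF a b]
    by (simp add: coprod_mor_def homD(3)[OF f] homD(3)[OF g])
qed

lemma
  assumes "A \<in> obj C" "B \<in> obj C"
  shows comparison_hom: "comparison C A B \<in> hom C (A \<amalg> B) (A \<times>\<^bsub>C\<^esub> B)"
    and pr2_comparison: "pr2 C A B \<cdot> comparison C A B = copairing C (zero_mor C A B) (ident C B)"
proof -
  note 1 = copairing_hom[OF ident_hom[OF assms(1)] zero_mor_hom[OF assms(2,1)]]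
    and 2 = copairing_hom[OF zero_mor_hom[OF assms] ident_hom[OF assms(2)]]
  show "comparison C A B \<in> hom C (A \<amalg> B) (A \<times>\<^bsub>C\<^esub> B)"
    "pr2 C A B \<cdot> comparison C A B = copairing C (zero_mor C A B) (ident C B)"
    using pairing_hom[OF 1 2] pr2_pairing[OF 1 2] by (simp_all add: comparison_def)
qed

lemma kernel_pr2:
  assumes Y: "Y \<in> obj C"
  shows "is_kernel C (pairing C (ident C Y) (zero_mor C Y Y)) (pr2 C Y Y)"
proof -
  note i = ident_hom[OF Y] and z = zero_mor_hom[OF Y Y] and p1 = pr1_hom[OF Y Y]
    and p2 = pr2_hom[OF Y Y]
  let ?k = "pairing C (ident C Y) (zero_mor C Y Y)"
  note k = pairing_hom[OF i z]
  have "\<exists>!h. h \<in> hom C A Y \<and> ?k \<cdot> h = g"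
    if g: "g \<in> hom C A (Y \<times>\<^bsub>C\<^esub> Y)" and g0: "pr2 C Y Y \<cdot> g = zero_mor C A Y" for A g
  proof (rule ex1I[of _ "pr1 C Y Y \<cdot> g"])
    note h = comp_hom[OF g p1]
    have kh: "?k \<cdot> (pr1 C Y Y \<cdot> g) = pairing C (pr1 C Y Y \<cdot> g) (zero_mor C A Y)"
      using pairing_comp[OF i z h] ident_left[OF h] zero_mor_comp[OF h Y] by simp
    have zA: "zero_mor C A Y \<in> hom C A Y" using zero_mor_hom[OF hom_obj[OF h]] .
    have "?k \<cdot> (pr1 C Y Y \<cdot> g) = g"
      using kh g0 prd_eqI[OF pairing_hom[OF h zA] g Y Y] pr1_pairing[OF h zA] pr2_pairing[OF h zA]
      by simp
    then show "pr1 C Y Y \<cdot> g \<in> hom C A Y \<and> ?k \<cdot> (pr1 C Y Y \<cdot> g) = g" using h by blast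
  next
    fix h assume "h \<in> hom C A Y \<and> ?k \<cdot> h = g"
    then have h: "h \<in> hom C A Y" and "g = ?k \<cdot> h" by simp_all
    then show "h = pr1 C Y Y \<cdot> g"
      using comp_assoc[OF h k p1] pr1_pairing[OF i z] ident_left[OF h] by simp
  qed
  then show ?thesis
    unfolding is_kernel_def homD(2)[OF k] homD(3)[OF k] homD(2)[OF p2] homD(3)[OF p2]
    using homD(1)[OF k] homD(1)[OF p2] pr2_pairing[OF i z] by simp
qed

end


section \<open>The imaginary addition\<close>

locale imaginary_splitting = pointed_category_with_products_coproducts C
  for C :: "('o, 'm, 'x) prod_coprod_cat_scheme" (structure) +
  fixes P :: "('o, 'm) comonad_data" and t :: "'o \<Rightarrow> 'o \<Rightarrow> 'm"
  assumes comonad: "comonad C P"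
    and splitting: "natural_imaginary_splitting C P t"
begin

abbreviation "\<mu> \<equiv> imag_add C t"

lemma P_functor: "cat_functor C C (Pob P) (Pmor P)"
  using comonad by (simp add: comonad_def)

lemma P_hom: "f \<in> hom C A B \<Longrightarrow> Pmor P f \<in> hom C (Pob P A) (Pob P B)"
  using P_functor homD[of f C A B] unfolding cat_functor_def by auto

lemma P_comp:
  assumes "f \<in> hom C A B" "g \<in> hom C B D"
  shows "Pmor P (g \<cdot> f) = Pmor P g \<cdot> Pmor P f"
  using P_functor assms homD[of f C A B] homD[of g C B D] unfolding cat_functor_def by auto

lemma counit_hom: "A \<in> obj C \<Longrightarrow> counit P A \<in> hom C (Pob P A) A"
  using comonad by (simp add: comonad_def natural_transformation_def)

lemma comult_hom: "A \<in> obj C \<Longrightarrow> comult P A \<in> hom C (Pob P A) (Pob P (Pob P A))"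
  using comonad by (simp add: comonad_def natural_transformation_def)

lemma counit_natural:
  assumes "f \<in> hom C A B"
  shows "counit P B \<cdot> Pmor P f = f \<cdot> counit P A"
proof -
  have "\<forall>f \<in> arr C. f \<cdot> counit P (src C f) = counit P (tgt C f) \<cdot> Pmor P f"
    using comonad by (simp add: comonad_def natural_transformation_def)
  from bspec[OF this homD(1)[OF assms]] show ?thesis by (simp add: homD[OF assms])
qed

lemma P_counit_comult: "A \<in> obj C \<Longrightarrow> Pmor P (counit P A) \<cdot> comult P A = ident C (Pob P A)"
  using comonad by (simp add: comonad_def)

lemma real_mor_eq: "f \<in> hom C A B \<Longrightarrow> real_mor C P f = f \<cdot> counit P A"
  by (simp add: real_mor_def homD)

lemma real_mor_hom: "f \<in> hom C A B \<Longrightarrow> real_mor C P f \<in> hom C (Pob P A) B"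
  using comp_hom[OF counit_hom] hom_obj(1) by (simp add: real_mor_eq)

lemma real_mor_comp:
  assumes "f \<in> hom C A B" "v \<in> hom C B D"
  shows "v \<cdot> real_mor C P f = real_mor C P (v \<cdot> f)"
  using comp_assoc[OF counit_hom[OF hom_obj(1)[OF assms(1)]] assms] real_mor_eq[OF assms(1)]
    real_mor_eq[OF comp_hom[OF assms]] by simp

text \<open>By the counit law of the comonad, \<open>a \<circ> u\<close> is \<open>a P(u)\<close> for real \<open>u\<close>.\<close>

lemma P_real_mor_comult:
  assumes f: "f \<in> hom C A B"
  shows "Pmor P (real_mor C P f) \<cdot> comult P A = Pmor P f"
proof -
  note A = hom_obj(1)[OF f]
  show ?thesis
    using P_comp[OF counit_hom[OF A] f] P_counit_comult[OF A] ident_right[OF P_hom[OF f]]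
      comp_assoc[OF comult_hom[OF A] P_hom[OF counit_hom[OF A]] P_hom[OF f]] real_mor_eq[OF f]
    by simp
qed

lemma t_hom: "A \<in> obj C \<Longrightarrow> B \<in> obj C \<Longrightarrow> t A B \<in> hom C (Pob P (A \<times>\<^bsub>C\<^esub> B)) (A \<amalg> B)"
  and comparison_t: "A \<in> obj C \<Longrightarrow> B \<in> obj C \<Longrightarrow> comparison C A B \<cdot> t A B = counit P (A \<times>\<^bsub>C\<^esub> B)"
  using splitting by (simp_all add: natural_imaginary_splitting_def)

lemma t_natural:
  assumes "f \<in> hom C A A'" "g \<in> hom C B B'"
  shows "coprod_mor C f g \<cdot> t A B = t A' B' \<cdot> Pmor P (prod_mor C f g)"
proof -
  have "\<forall>f \<in> arr C. \<forall>g \<in> arr C. coprod_mor C f g \<cdot> t (src C f) (src C g)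
      = t (tgt C f) (tgt C g) \<cdot> Pmor P (prod_mor C f g)"
    using splitting by (simp add: natural_imaginary_splitting_def)
  from bspec[OF bspec[OF this homD(1)[OF assms(1)]] homD(1)[OF assms(2)]]
  show ?thesis by (simp add: homD[OF assms(1)] homD[OF assms(2)])
qed

lemma imag_add_hom:
  assumes X: "X \<in> obj C"
  shows "\<mu> X \<in> hom C (Pob P (X \<times>\<^bsub>C\<^esub> X)) X"
  unfolding imag_add_def
  using comp_hom[OF t_hom[OF X X] copairing_hom[OF ident_hom[OF X] ident_hom[OF X]]] .

text \<open>
  This form of the naturality of \<open>t\<close> is the source of both the naturality of the addition and its
  left unit law.
\<close>

lemma imag_add_prod_mor:
  assumes f: "f \<in> hom C A X" and g: "g \<in> hom C B X"
  shows "\<mu> X \<cdot> Pmor P (prod_mor C f g) = copairing C f g \<cdot> t A B"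
proof -
  note A = hom_obj(1)[OF f] and B = hom_obj(1)[OF g] and X = hom_obj(2)[OF f]
  note i = ident_hom[OF X]
  note ii = copairing_hom[OF i i]
  have "\<mu> X \<cdot> Pmor P (prod_mor C f g)
      = copairing C (ident C X) (ident C X) \<cdot> (t X X \<cdot> Pmor P (prod_mor C f g))"
    unfolding imag_add_def
    using comp_assoc[OF P_hom[OF prod_mor_hom[OF f g]] t_hom[OF X X] ii] by simp
  also have "\<dots> = copairing C (ident C X) (ident C X) \<cdot> (coprod_mor C f g \<cdot> t A B)"
    using t_natural[OF f g] by simp
  also have "\<dots> = copairing C (ident C X \<cdot> f) (ident C X \<cdot> g) \<cdot> t A B"
    using comp_assoc[OF t_hom[OF A B] coprod_mor_hom[OF f g] ii]
      copairing_coprod_mor[OF f g i i] by simp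
  finally show ?thesis using ident_left[OF f] ident_left[OF g] by simp
qed

lemma imag_add_natural:
  assumes v: "v \<in> hom C X X'"
  shows "v \<cdot> \<mu> X = \<mu> X' \<cdot> Pmor P (prod_mor C v v)"
proof -
  note X = hom_obj(1)[OF v]
  note i = ident_hom[OF X]
  show ?thesis
    using imag_add_prod_mor[OF v v] comp_assoc[OF t_hom[OF X X] copairing_hom[OF i i] v]
      comp_copairing[OF i i v] ident_right[OF v]
    by (simp add: imag_add_def)
qed

lemma comp_imag_add_prod_mor:
  assumes v: "v \<in> hom C X X'" and f: "f \<in> hom C A X" and g: "g \<in> hom C B X"
  shows "v \<cdot> (\<mu> X \<cdot> Pmor P (prod_mor C f g)) = \<mu> X' \<cdot> Pmor P (prod_mor C (v \<cdot> f) (v \<cdot> g))"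
proof -
  note fg = prod_mor_hom[OF f g] and vv = prod_mor_hom[OF v v]
  show ?thesis
    using comp_assoc[OF P_hom[OF fg] imag_add_hom[OF hom_obj(1)[OF v]] v] imag_add_natural[OF v]
      comp_assoc[OF P_hom[OF fg] P_hom[OF vv] imag_add_hom[OF hom_obj(2)[OF v]]]
      P_comp[OF fg vv] prod_mor_comp[OF f g v v]
    by simp
qed

lemma imag_add_imag_hom:
  assumes A: "A \<in> obj C" and a: "a \<in> imag C P A X" and b: "b \<in> imag C P A X"
  shows "imag_comp C P A (\<mu> X) (pairing C a b) \<in> imag C P A X"
proof -
  note a' = a[unfolded imag_def] and b' = b[unfolded imag_def]
  show ?thesis
    unfolding imag_comp_def imag_def
    using comp_hom[OF comult_hom[OF A] comp_hom[OF P_hom[OF pairing_hom[OF a' b']]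
        imag_add_hom[OF hom_obj(2)[OF a']]]] .
qed

lemma comp_imag_add:
  assumes A: "A \<in> obj C" and a: "a \<in> imag C P A X" and b: "b \<in> imag C P A X"
    and v: "v \<in> hom C X X'"
  shows "v \<cdot> imag_comp C P A (\<mu> X) (pairing C a b)
    = imag_comp C P A (\<mu> X') (pairing C (v \<cdot> a) (v \<cdot> b))"
proof -
  note a' = a[unfolded imag_def] and b' = b[unfolded imag_def]
  note ab = pairing_hom[OF a' b'] and vv = prod_mor_hom[OF v v]
    and m = imag_add_hom[OF hom_obj(1)[OF v]] and m' = imag_add_hom[OF hom_obj(2)[OF v]]
  have "v \<cdot> (\<mu> X \<cdot> Pmor P (pairing C a b)) = \<mu> X' \<cdot> Pmor P (pairing C (v \<cdot> a) (v \<cdot> b))"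
    using comp_assoc[OF P_hom[OF ab] m v] imag_add_natural[OF v]
      comp_assoc[OF P_hom[OF ab] P_hom[OF vv] m'] P_comp[OF ab vv] prod_mor_pairing[OF a' b' v v]
    by simp
  then show ?thesis
    unfolding imag_comp_def
    using comp_assoc[OF comult_hom[OF A] comp_hom[OF P_hom[OF ab] m] v] by simp
qed

text \<open>
  Although \<open>t\<close> splits the comparison morphism only up to the counit, the copairing of \<open>0\<close> and \<open>w\<close>
  factors through that morphism, so its composite with \<open>t\<close> is determined.
\<close>

lemma imag_add_zero_prod:
  assumes A: "A \<in> obj C" and w: "w \<in> hom C B X"
  shows "\<mu> X \<cdot> Pmor P (prod_mor C (zero_mor C A X) w) = real_mor C P (w \<cdot> pr2 C A B)"
proof -
  note B = hom_obj(1)[OF w] and X = hom_obj(2)[OF w]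
  note z = zero_mor_hom[OF A X] and i = ident_hom[OF B] and zB = zero_mor_hom[OF A B]
  note r = comparison_hom[OF A B] and p2 = pr2_hom[OF A B]
  have "copairing C (zero_mor C A X) w
      = w \<cdot> copairing C (zero_mor C A B) (ident C B)"
    using comp_copairing[OF zB i w] comp_zero_mor[OF A w] ident_right[OF w] by simp
  also have "\<dots> = (w \<cdot> pr2 C A B) \<cdot> comparison C A B"
    using pr2_comparison[OF A B] comp_assoc[OF r p2 w] by simp
  finally have "\<mu> X \<cdot> Pmor P (prod_mor C (zero_mor C A X) w)
      = ((w \<cdot> pr2 C A B) \<cdot> comparison C A B) \<cdot> t A B"
    using imag_add_prod_mor[OF z w] by simp
  also have "\<dots> = (w \<cdot> pr2 C A B) \<cdot> counit P (A \<times>\<^bsub>C\<^esub> B)"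
    using comp_assoc[OF t_hom[OF A B] r comp_hom[OF p2 w]] comparison_t[OF A B] by simp
  finally show ?thesis using real_mor_eq[OF comp_hom[OF p2 w]] by simp
qed

lemma imag_add_zero_left:
  assumes w: "w \<in> hom C A X"
  shows "imag_comp C P A (\<mu> X) (pairing C (zero_mor C (Pob P A) X) (real_mor C P w))
    = real_mor C P w"
proof -
  note A = hom_obj(1)[OF w] and X = hom_obj(2)[OF w]
  note i = ident_hom[OF A] and z = zero_mor_hom[OF A X] and p2 = pr2_hom[OF A A]
    and m = imag_add_hom[OF X]
  note d = pairing_hom[OF i i] and zw = prod_mor_hom[OF z w]
  let ?d = "pairing C (ident C A) (ident C A)" and ?zw = "prod_mor C (zero_mor C A X) w"
  have e: "?zw \<cdot> ?d = pairing C (zero_mor C A X) w"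
    using prod_mor_pairing[OF i i z w] ident_right[OF z] ident_right[OF w] by simp
  have "pairing C (zero_mor C (Pob P A) X) (real_mor C P w) = real_mor C P (?zw \<cdot> ?d)"
    using pairing_comp[OF z w counit_hom[OF A]] zero_mor_comp[OF counit_hom[OF A] X] e
      real_mor_eq[OF w] real_mor_eq[OF comp_hom[OF d zw]] by simp
  then have "imag_comp C P A (\<mu> X) (pairing C (zero_mor C (Pob P A) X) (real_mor C P w))
      = \<mu> X \<cdot> Pmor P (?zw \<cdot> ?d)"
    unfolding imag_comp_def
    using comp_assoc[OF comult_hom[OF A] P_hom[OF real_mor_hom[OF comp_hom[OF d zw]]] m]
      P_real_mor_comult[OF comp_hom[OF d zw]] by simp
  also have "\<dots> = real_mor C P (w \<cdot> pr2 C A A) \<cdot> Pmor P ?d"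
    using P_comp[OF d zw] comp_assoc[OF P_hom[OF d] P_hom[OF zw] m] imag_add_zero_prod[OF A w]
    by simp
  also have "\<dots> = (w \<cdot> pr2 C A A) \<cdot> (?d \<cdot> counit P A)"
    using real_mor_eq[OF comp_hom[OF p2 w]] counit_natural[OF d]
      comp_assoc[OF P_hom[OF d] counit_hom[OF prd_obj[OF A A]] comp_hom[OF p2 w]] by simp
  also have "\<dots> = (w \<cdot> (pr2 C A A \<cdot> ?d)) \<cdot> counit P A"
    using comp_assoc[OF counit_hom[OF A] d comp_hom[OF p2 w]] comp_assoc[OF d p2 w] by simp
  also have "\<dots> = real_mor C P w"
    using pr2_pairing[OF i i] ident_right[OF w] real_mor_eq[OF w] by simp
  finally show ?thesis .
qed


section \<open>Schreier retractions of the second projection\<close>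

context
  fixes Y
  assumes Y: "Y \<in> obj C"
begin

text \<open>
  Both sides of the first Schreier equation are morphisms into \<open>Y \<times> Y\<close>; its second component is
  an instance of the left unit law, so only the first component is a condition on \<open>q\<close>.
\<close>

lemma first_schreier_equation_iff:
  assumes q: "q \<in> imag C P (Y \<times>\<^bsub>C\<^esub> Y) Y"
  defines "s \<equiv> pairing C (ident C Y) (ident C Y)"
    and "k \<equiv> pairing C (ident C Y) (zero_mor C Y Y)"
  shows "imag_comp C P (Y \<times>\<^bsub>C\<^esub> Y) (\<mu> (Y \<times>\<^bsub>C\<^esub> Y)) (pairing C (k \<cdot> q) (real_mor C P (s \<cdot> pr2 C Y Y)))
        = real_mor C P (ident C (Y \<times>\<^bsub>C\<^esub> Y)) \<longleftrightarrow>
      imag_comp C P (Y \<times>\<^bsub>C\<^esub> Y) (\<mu> Y) (pairing C q (real_mor C P (pr2 C Y Y)))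
        = real_mor C P (pr1 C Y Y)"
    (is "?lhs = ?id \<longleftrightarrow> ?loop")
proof -
  note q' = q[unfolded imag_def]
  note i = ident_hom[OF Y] and z = zero_mor_hom[OF Y Y] and p1 = pr1_hom[OF Y Y]
    and p2 = pr2_hom[OF Y Y] and YY = prd_obj[OF Y Y]
  have k: "k \<in> hom C Y (Y \<times>\<^bsub>C\<^esub> Y)" "pr1 C Y Y \<cdot> k = ident C Y" "pr2 C Y Y \<cdot> k = zero_mor C Y Y"
    unfolding k_def by (rule pairing_hom[OF i z] pr1_pairing[OF i z] pr2_pairing[OF i z])+
  have s: "s \<in> hom C Y (Y \<times>\<^bsub>C\<^esub> Y)" "pr1 C Y Y \<cdot> s = ident C Y" "pr2 C Y Y \<cdot> s = ident C Y"
    unfolding s_def by (rule pairing_hom[OF i i] pr1_pairing[OF i i] pr2_pairing[OF i i])+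
  note kq = comp_hom[OF q' k(1)] and sp = comp_hom[OF p2 s(1)]
  note kq' = kq[folded imag_def] and sp' = real_mor_hom[OF sp, folded imag_def]
  have "pr1 C Y Y \<cdot> (k \<cdot> q) = q"
    using comp_assoc[OF q' k(1) p1] k(2) ident_left[OF q'] by simp
  moreover have "pr1 C Y Y \<cdot> real_mor C P (s \<cdot> pr2 C Y Y) = real_mor C P (pr2 C Y Y)"
    using real_mor_comp[OF sp p1] comp_assoc[OF p2 s(1) p1] s(2) ident_left[OF p2] by simp
  ultimately have 1: "pr1 C Y Y \<cdot> ?lhs
      = imag_comp C P (Y \<times>\<^bsub>C\<^esub> Y) (\<mu> Y) (pairing C q (real_mor C P (pr2 C Y Y)))"
    using comp_imag_add[OF YY kq' sp' p1] by simp
  have "pr2 C Y Y \<cdot> (k \<cdot> q) = zero_mor C (Pob P (Y \<times>\<^bsub>C\<^esub> Y)) Y"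
    using comp_assoc[OF q' k(1) p2] k(3) zero_mor_comp[OF q' Y] by simp
  moreover have "pr2 C Y Y \<cdot> real_mor C P (s \<cdot> pr2 C Y Y) = real_mor C P (pr2 C Y Y)"
    using real_mor_comp[OF sp p2] comp_assoc[OF p2 s(1) p2] s(3) ident_left[OF p2] by simp
  ultimately have 2: "pr2 C Y Y \<cdot> ?lhs = real_mor C P (pr2 C Y Y)"
    using comp_imag_add[OF YY kq' sp' p2] imag_add_zero_left[OF p2] by simp
  note iYY = ident_hom[OF YY]
  have 3: "pr1 C Y Y \<cdot> ?id = real_mor C P (pr1 C Y Y)" "pr2 C Y Y \<cdot> ?id = real_mor C P (pr2 C Y Y)"
    using real_mor_comp[OF iYY p1] real_mor_comp[OF iYY p2] ident_right[OF p1] ident_right[OF p2]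
    by simp_all
  have "?lhs \<in> hom C (Pob P (Y \<times>\<^bsub>C\<^esub> Y)) (Y \<times>\<^bsub>C\<^esub> Y)"
    using imag_add_imag_hom[OF YY kq' sp'] by (simp add: imag_def)
  then show ?thesis
    using prd_eqI[OF _ real_mor_hom[OF iYY] Y Y] 1 2 3 by metis
qed

lemma imag_add_kernel_section:
  "\<mu> (Y \<times>\<^bsub>C\<^esub> Y) \<cdot> Pmor P (prod_mor C (pairing C (ident C Y) (zero_mor C Y Y))
        (pairing C (ident C Y) (ident C Y)))
    = pairing C (\<mu> Y) (real_mor C P (pr2 C Y Y))" (is "?lhs = _")
proof -
  note i = ident_hom[OF Y] and z = zero_mor_hom[OF Y Y] and p1 = pr1_hom[OF Y Y]
    and p2 = pr2_hom[OF Y Y] and YY = prd_obj[OF Y Y] and m = imag_add_hom[OF Y]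
  note k = pairing_hom[OF i z] and s = pairing_hom[OF i i] and rp = real_mor_hom[OF p2]
  have l: "?lhs \<in> hom C (Pob P (Y \<times>\<^bsub>C\<^esub> Y)) (Y \<times>\<^bsub>C\<^esub> Y)"
    using comp_hom[OF P_hom[OF prod_mor_hom[OF k s]] imag_add_hom[OF YY]] .
  have "pr1 C Y Y \<cdot> ?lhs = \<mu> Y \<cdot> Pmor P (prod_mor C (ident C Y) (ident C Y))"
    using comp_imag_add_prod_mor[OF p1 k s] pr1_pairing[OF i z] pr1_pairing[OF i i] by simp
  then have 1: "pr1 C Y Y \<cdot> ?lhs = \<mu> Y"
    using imag_add_prod_mor[OF i i] by (simp add: imag_add_def)
  have 2: "pr2 C Y Y \<cdot> ?lhs = real_mor C P (pr2 C Y Y)"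
    using comp_imag_add_prod_mor[OF p2 k s] pr2_pairing[OF i z] pr2_pairing[OF i i]
      imag_add_zero_prod[OF Y i] ident_left[OF p2] by simp
  show ?thesis
    using prd_eqI[OF l pairing_hom[OF m rp] Y Y] 1 2 pr1_pairing[OF m rp] pr2_pairing[OF m rp]
    by simp
qed

lemma schreier_special_iff_one_sided_loop:
  "intrinsic_schreier_special C P t Y \<longleftrightarrow> one_sided_loop_structure C P Y (\<mu> Y)"
proof -
  note i = ident_hom[OF Y] and z = zero_mor_hom[OF Y Y] and p2 = pr2_hom[OF Y Y]
  note k = pairing_hom[OF i z] and s = pairing_hom[OF i i]
  show ?thesis
    unfolding intrinsic_schreier_special_def intrinsic_schreier_split_epi_def Let_def
      one_sided_loop_structure_def homD(2)[OF p2] homD(3)[OF p2] homD(2)[OF k]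
    using Y homD(1)[OF p2] s pr2_pairing[OF i i] kernel_pr2[OF Y] imag_add_hom[OF Y]
    by (simp add: imag_add_kernel_section first_schreier_equation_iff
        imag_def[of C P "Y \<times>\<^bsub>C\<^esub> Y" Y] cong: bex_cong)
qed

end

end

theorem theorem8p2:
  fixes C :: "('o, 'm) prod_coprod_cat"
    and P :: "('o, 'm) comonad_data"
    and t :: "'o \<Rightarrow> 'o \<Rightarrow> 'm"
    and Y :: 'o
  assumes "regular_category C"
    and "unital_category C"
    and "binary_coproducts C"
    and "comonadic_covers C P"
    and "natural_imaginary_splitting C P t"
    and "Y \<in> obj C"
  shows "intrinsic_schreier_special C P t Y \<longleftrightarrow>
           one_sided_loop_structure C P Y (imag_add C t Y)"
proof -
  have "category C" "pointed C" "binary_products C" "comonad C P"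
    using assms(2,4) by (simp_all add: unital_category_def comonadic_covers_def)
  then interpret imaginary_splitting C P t
    using assms(3,5)
    by (simp add: imaginary_splitting_def imaginary_splitting_axioms_def
        pointed_category_with_products_coproducts_def pointed_category_with_products_coproducts_axioms_def)
  show ?thesis using schreier_special_iff_one_sided_loop[OF assms(6)] .
qed

end
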